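(* Let $D\ge 1$, $\lambda>0$, $\phi\in(0,\pi/2]$, put $c_1=\frac{\lambda^{-1}}{4}\sin^2\phi$ and $c_2=\lambda^{-1}c_1(1-\cos\phi)$ (both positive), and let $\Phi\in C^2(\mathbb{R}^D)$ satisfy: (H1) $\Phi(q)\ge 0$ for all $q$ and $\int_{\mathbb{R}^D}|q|^2e^{-\Phi(q)}\,dq<\infty$; (H2) there exist $a>0$ and $b\in(0,1)$ such that $$\tfrac12\langle\nabla\Phi(q),q\rangle\ \ge\ b\,\Phi(q)+\frac{(c_1b)^2+c_2b(1-b)}{2(1-b)}|q|^2-a\qquad\text{for all } q\in\mathbb{R}^D.$$ Let $V(q,p)=\frac{|p|^2}{2}+\Phi(q)+c_1\langle q,p\rangle+c_2\frac{|q|^2}{2}$ for $(q,p)\in\mathbb{R}^{2D}$. Then there exist real positive constants $\gamma$ and $K$ such that $$LV(z)\le-\gamma V(z)+K\qquad\text{for all } z\in\mathbb{R}^{2D}.$$ Moreover, $V$ is nonnegative and $\lim_{|z|\to\infty}V(z)=\infty$.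
   Context: The operator $L$ (generator of RHMC) acts on $C^1$ functions $f:\mathbb{R}^{2D}\to\mathbb{R}$ (for which the expectation exists) by $$Lf(q,p)=\lambda^{-1}\,\mathbb{E}\{f(\Gamma(q,p))-f(q,p)\}+p^T\nabla_qf(q,p)-\nabla\Phi(q)^T\nabla_pf(q,p),$$ where $\Gamma(q,p)=(q,\cos(\phi)p+\sin(\phi)\xi)$ and the expectation is over the standard Gaussian vector $\xi\sim\mathcal N(0,1)^D$. *)

theory Defs
  imports "HOL-Probability.Probability"
begin

definition C1_fun :: "('a::real_normed_vector \<Rightarrow> 'b::real_normed_vector) \<Rightarrow> bool" where
  "C1_fun f \<longleftrightarrow> (\<exists>f' :: 'a \<Rightarrow> ('a \<Rightarrow>\<^sub>L 'b).
     (\<forall>x. (f has_derivative blinfun_apply (f' x)) (at x)) \<and> continuous_on UNIV f')"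

definition C2_fun :: "('a::real_normed_vector \<Rightarrow> 'b::real_normed_vector) \<Rightarrow> bool" where
  "C2_fun f \<longleftrightarrow> (\<exists>f' :: 'a \<Rightarrow> ('a \<Rightarrow>\<^sub>L 'b).
     (\<forall>x. (f has_derivative blinfun_apply (f' x)) (at x)) \<and> C1_fun f')"

text \<open>Unspecified at points where the function is not differentiable.\<close>
definition grad :: "('a::real_inner \<Rightarrow> real) \<Rightarrow> 'a \<Rightarrow> 'a" where
  "grad f x = (THE d. GDERIV f x :> d)"

lemma grad_eqI: "GDERIV f x :> d \<Longrightarrow> grad f x = d"
  unfolding grad_def
proof (rule the_equality)
  fix e assume "GDERIV f x :> d" "GDERIV f x :> e"
  then have "(\<lambda>h. inner h e) = (\<lambda>h. inner h d)"
    unfolding gderiv_def by (rule has_derivative_unique[rotated])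
  then show "e = d"
    by (metis inner_commute vector_eq_ldot)
qed

definition std_gaussian :: "(real ^ 'n) measure" where
  "std_gaussian = distr (\<Pi>\<^sub>M i\<in>(UNIV :: 'n set). density lborel std_normal_density) borel (\<lambda>x. \<chi> i. x i)"

definition momentum_refresh ::
  "real \<Rightarrow> (real ^ 'n) \<times> (real ^ 'n) \<Rightarrow> real ^ 'n \<Rightarrow> (real ^ 'n) \<times> (real ^ 'n)" where
  "momentum_refresh phi z \<xi> = (fst z, cos phi *\<^sub>R snd z + sin phi *\<^sub>R \<xi>)"

text \<open>
  The functions on which the generator acts. Membership has to be tracked separately because
  the Bochner integral is 0 when the integrand is not integrable.
\<close>
definition RHMC_domain :: "real \<Rightarrow> ((real ^ 'n) \<times> (real ^ 'n) \<Rightarrow> real) set" where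
  "RHMC_domain phi = {f. C1_fun f \<and>
     (\<forall>z. integrable std_gaussian (\<lambda>\<xi>. f (momentum_refresh phi z \<xi>) - f z))}"

definition RHMC_generator ::
  "real \<Rightarrow> real \<Rightarrow> (real ^ 'n \<Rightarrow> real) \<Rightarrow> ((real ^ 'n) \<times> (real ^ 'n) \<Rightarrow> real)
     \<Rightarrow> (real ^ 'n) \<times> (real ^ 'n) \<Rightarrow> real" where
  "RHMC_generator lam phi \<Phi> f = (\<lambda>(q, p).
     inverse lam * (\<integral>\<xi>. (f (momentum_refresh phi (q, p) \<xi>) - f (q, p)) \<partial>std_gaussian)
     + inner p (grad (\<lambda>q'. f (q', p)) q)
     - inner (grad \<Phi> q) (grad (\<lambda>p'. f (q, p')) p))"

end

theory Submission
  imports Defs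
begin

text \<open>
  Write \<open>s = sin phi\<close>, \<open>c = cos phi\<close> and \<open>\<mu> = 1 / lam\<close>. The refreshment term of the generator
  only needs the first two moments of the Gaussian vector and turns the kinetic energy into
  \<open>- \<mu> s\<^sup>2 / 2 * |p|\<^sup>2 + const = - 2 c1 |p|\<^sup>2 + const\<close> and the cross term into
  \<open>- \<mu> c1 (1 - c) \<langle>q, p\<rangle> = - c2 \<langle>q, p\<rangle>\<close>. The transport part contributes
  \<open>c1 |p|\<^sup>2 + c2 \<langle>q, p\<rangle> - c1 \<langle>\<nabla>\<Phi> q, q\<rangle>\<close>, the terms \<open>\<plusminus> \<langle>p, \<nabla>\<Phi> q\<rangle>\<close> cancelling by conservation of
  energy. The coefficients \<open>c1\<close> and \<open>c2\<close> are tuned so that the terms in \<open>\<langle>q, p\<rangle>\<close> disappear: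
  \<open>L V (q, p) = - c1 |p|\<^sup>2 - c1 \<langle>\<nabla>\<Phi> q, q\<rangle> + 2 c1 D\<close> with \<open>D = CARD('n)\<close>
  (lemma \<open>RHMC_generator_lyapunov\<close>). Inserting the growth condition on \<open>\<Phi>\<close> and taking
  \<open>\<gamma> = 2 c1 b\<close>, the difference between
  \<open>- \<gamma> V + 2 c1 (D + a)\<close> and the resulting bound is \<open>c1 / (1 - b)\<close> times the perfect square
  \<open>|(1 - b) p - c1 b q|\<^sup>2\<close> (lemma \<open>drift_square\<close>).

  Nonnegativity and coercivity of \<open>V\<close> come from its quadratic part being positive definite, that is
  from \<open>c1\<^sup>2 < c2\<close>. Indeed \<open>s\<^sup>2 = (1 - c) (1 + c)\<close> gives \<open>c1\<^sup>2 = c2 (1 + c) / 4 \<le> c2 / 2\<close>.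
\<close>

section \<open>Continuously differentiable functions\<close>

lemma C1_fun_add:
  assumes "C1_fun f" "C1_fun g"
  shows "C1_fun (\<lambda>x. f x + g x)"
proof -
  obtain f' g' where
    "\<And>x. (f has_derivative blinfun_apply (f' x)) (at x)" "continuous_on UNIV f'"
    "\<And>x. (g has_derivative blinfun_apply (g' x)) (at x)" "continuous_on UNIV g'"
    using assms unfolding C1_fun_def by blast
  then show ?thesis
    unfolding C1_fun_def
    by (intro exI[of _ "\<lambda>x. f' x + g' x"])
       (auto simp: plus_blinfun.rep_eq intro!: has_derivative_add continuous_on_add)
qed

lemma C1_fun_compose_blinfun:
  fixes T :: "'a::real_normed_vector \<Rightarrow>\<^sub>L 'b::real_normed_vector"
  assumes "C1_fun f"
  shows "C1_fun (\<lambda>x. f (T x))"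
proof -
  obtain f' where f': "\<And>x. (f has_derivative blinfun_apply (f' x)) (at x)"
    and cont: "continuous_on UNIV f'"
    using assms unfolding C1_fun_def by blast
  have "((\<lambda>x. f (T x)) has_derivative blinfun_apply (f' (T x) o\<^sub>L T)) (at x)" for x
  proof -
    have "((\<lambda>x. T x) has_derivative blinfun_apply T) (at x)"
      by (intro bounded_linear_imp_has_derivative blinfun.bounded_linear_right)
    from has_derivative_compose[OF this f'] show ?thesis
      by (simp add: blinfun_compose.rep_eq comp_def)
  qed
  moreover have "continuous_on UNIV (\<lambda>x. f' (T x) o\<^sub>L T)"
    by (intro continuous_intros continuous_on_compose2[OF cont]) auto
  ultimately show ?thesis
    unfolding C1_fun_def by (intro exI[of _ "\<lambda>x. f' (T x) o\<^sub>L T"]) auto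
qed

lemma C1_fun_inner_blinfun:
  fixes S T :: "'a::real_normed_vector \<Rightarrow>\<^sub>L 'b::real_inner"
  shows "C1_fun (\<lambda>x. inner (S x) (T x))"
proof -
  let ?f' = "\<lambda>x. (blinfun_inner_right (S x) o\<^sub>L T) + (blinfun_inner_left (T x) o\<^sub>L S)"
  have "((\<lambda>x. inner (S x) (T x)) has_derivative blinfun_apply (?f' x)) (at x)" for x
    by (auto intro!: derivative_eq_intros simp: plus_blinfun.rep_eq fun_eq_iff blinfun.zero_left)
  moreover have "continuous_on UNIV ?f'"
    by (intro continuous_intros)
  ultimately show ?thesis
    unfolding C1_fun_def by (intro exI[of _ ?f']) auto
qed

lemma C2_fun_imp_C1_fun:
  assumes "C2_fun f"
  shows "C1_fun f"
proof -
  obtain f' where f': "\<And>x. (f has_derivative blinfun_apply (f' x)) (at x)" and "C1_fun f'"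
    using assms unfolding C2_fun_def by blast
  from \<open>C1_fun f'\<close> have "continuous_on UNIV f'"
    unfolding C1_fun_def
    by (blast intro: continuous_at_imp_continuous_on has_derivative_continuous)
  with f' show ?thesis
    unfolding C1_fun_def by blast
qed

text \<open>In finite dimension a derivative is represented by a vector, so that the definite description
  behind \<open>grad\<close> does denote a gradient.\<close>

lemma C1_fun_GDERIV_grad:
  fixes f :: "'a::euclidean_space \<Rightarrow> real"
  assumes "C1_fun f"
  shows "GDERIV f x :> grad f x"
proof -
  obtain f' where f': "(f has_derivative blinfun_apply f') (at x)"
    using assms unfolding C1_fun_def by blast
  define d where "d = (\<Sum>b\<in>Basis. f' b *\<^sub>R b)"
  have "f' h = inner h d" for h
  proof -
    have "f' h = f' (\<Sum>b\<in>Basis. inner h b *\<^sub>R b)"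
      by (simp add: euclidean_representation)
    also have "\<dots> = inner h d"
      by (simp add: d_def blinfun.sum_right blinfun.scaleR_right inner_sum_right mult.commute)
    finally show ?thesis .
  qed
  then have "blinfun_apply f' = (\<lambda>h. inner h d)" ..
  with f' have "GDERIV f x :> d"
    by (simp add: gderiv_def)
  then show ?thesis
    by (simp add: grad_eqI)
qed

section \<open>Moments of the standard Gaussian vector\<close>

lemma prob_space_std_normal: "prob_space (density lborel std_normal_density)"
  by (rule prob_space_normal_density) simp

lemma measurable_vec_lambda_PiM:
  "(\<lambda>x. \<chi> i. x i) \<in> measurable
     (\<Pi>\<^sub>M i\<in>(UNIV :: 'n::finite set). density lborel std_normal_density) (borel :: (real ^ 'n) measure)"
  by (subst borel_measurable_euclidean_space)
     (auto simp: Basis_vec_def inner_axis intro!: measurable_component_singleton[THEN measurable_compose])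

lemma prob_space_std_gaussian: "prob_space (std_gaussian :: (real ^ 'n) measure)"
  unfolding std_gaussian_def
  by (intro prob_space.prob_space_distr prob_space_PiM prob_space_std_normal measurable_vec_lambda_PiM)

lemma measurable_nth_std_gaussian:
  "(\<lambda>\<xi> :: real ^ 'n. \<xi> $ i) \<in> borel_measurable std_gaussian"
  by (simp add: std_gaussian_def)

lemma distr_std_gaussian_nth:
  "distr (std_gaussian :: (real ^ 'n) measure) borel (\<lambda>\<xi>. \<xi> $ i) = density lborel std_normal_density"
proof -
  let ?P = "\<Pi>\<^sub>M i\<in>(UNIV :: 'n set). density lborel std_normal_density"
  have "distr (std_gaussian :: (real ^ 'n) measure) borel (\<lambda>\<xi>. \<xi> $ i) = distr ?P borel (\<lambda>x. x i)"
    unfolding std_gaussian_def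
    by (subst distr_distr) (auto simp: comp_def intro!: measurable_vec_lambda_PiM)
  also have "\<dots> = distr ?P (density lborel std_normal_density) (\<lambda>x. x i)"
    by (rule distr_cong) auto
  also have "\<dots> = density lborel std_normal_density"
    by (rule distr_PiM_component) (auto intro: prob_space_std_normal)
  finally show ?thesis .
qed

lemma has_bochner_integral_std_gaussian_nth_power:
  assumes "has_bochner_integral lborel (\<lambda>x. std_normal_density x * x ^ k) m"
  shows "has_bochner_integral (std_gaussian :: (real ^ 'n) measure) (\<lambda>\<xi>. (\<xi> $ i) ^ k) m"
proof -
  have "has_bochner_integral (density lborel std_normal_density) (\<lambda>x. x ^ k) m"
    using assms by (intro has_bochner_integral_density) (auto simp: real_scaleR_def)
  then have "has_bochner_integral (distr (std_gaussian :: (real ^ 'n) measure) borel (\<lambda>\<xi>. \<xi> $ i))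
      (\<lambda>x. x ^ k) m"
    by (simp add: distr_std_gaussian_nth)
  then show ?thesis
    by (simp add: has_bochner_integral_iff integrable_distr_eq integral_distr measurable_nth_std_gaussian)
qed

lemma has_bochner_integral_std_gaussian_inner:
  fixes v :: "real ^ 'n"
  shows "has_bochner_integral std_gaussian (\<lambda>\<xi>. inner v \<xi>) 0"
proof -
  have "has_bochner_integral (std_gaussian :: (real ^ 'n) measure) (\<lambda>\<xi>. (\<xi> $ i) ^ 1) 0" for i
    using std_normal_moment_odd[of 0] by (intro has_bochner_integral_std_gaussian_nth_power) simp
  then have "has_bochner_integral (std_gaussian :: (real ^ 'n) measure)
      (\<lambda>\<xi>. \<Sum>i\<in>UNIV. v $ i * \<xi> $ i) (\<Sum>i\<in>(UNIV :: 'n set). v $ i * 0)"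
    by (intro has_bochner_integral_sum has_bochner_integral_mult_right) simp
  then show ?thesis
    by (simp add: inner_vec_def)
qed

lemma has_bochner_integral_std_gaussian_norm_square:
  "has_bochner_integral std_gaussian (\<lambda>\<xi> :: real ^ 'n. (norm \<xi>)\<^sup>2) (real CARD('n))"
proof -
  have "has_bochner_integral (std_gaussian :: (real ^ 'n) measure) (\<lambda>\<xi>. (\<xi> $ i)\<^sup>2) 1" for i
    using has_bochner_integral_std_gaussian_nth_power[of 2 1] std_normal_moment_even[of 1]
    by (simp add: fact_numeral)
  then have "has_bochner_integral (std_gaussian :: (real ^ 'n) measure)
      (\<lambda>\<xi>. \<Sum>i\<in>UNIV. (\<xi> $ i)\<^sup>2) (\<Sum>i\<in>(UNIV :: 'n set). 1)"
    by (intro has_bochner_integral_sum) simp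
  then show ?thesis
    by (simp add: norm_vec_def L2_set_def sum_nonneg)
qed

lemma has_bochner_integral_std_gaussian_quadratic:
  fixes v :: "real ^ 'n"
  shows "has_bochner_integral std_gaussian
    (\<lambda>\<xi>. \<alpha> + inner v \<xi> + \<beta> * (norm \<xi>)\<^sup>2) (\<alpha> + \<beta> * real CARD('n))"
proof -
  interpret prob_space "std_gaussian :: (real ^ 'n) measure"
    by (rule prob_space_std_gaussian)
  have "has_bochner_integral (std_gaussian :: (real ^ 'n) measure) (\<lambda>_. \<alpha>) \<alpha>"
    by (simp add: has_bochner_integral_iff prob_space)
  from has_bochner_integral_add[OF has_bochner_integral_add[OF this
      has_bochner_integral_std_gaussian_inner[of v]]
      has_bochner_integral_mult_right[OF has_bochner_integral_std_gaussian_norm_square, of \<beta>]]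
  show ?thesis by simp
qed

section \<open>Two quadratic inequalities\<close>

text \<open>The expansion of \<open>|(1 - b) p - c b q|\<^sup>2 \<ge> 0\<close>. The coefficient of \<open>|q|\<^sup>2\<close> is the part of the
  growth condition that absorbs the cross term of \<open>\<gamma> V\<close>; the remaining part \<open>c2 b / 2\<close> there is the
  one that matches the \<open>|q|\<^sup>2\<close> term of \<open>V\<close>.\<close>

lemma drift_square:
  fixes p q :: "'a::real_inner" and b c :: real
  assumes "b < 1"
  shows "c * b * inner q p \<le> (1 - b) / 2 * (norm p)\<^sup>2 + (c * b)\<^sup>2 / (2 * (1 - b)) * (norm q)\<^sup>2"
proof -
  have "0 \<le> (norm ((1 - b) *\<^sub>R p - (c * b) *\<^sub>R q))\<^sup>2"
    by simp
  also have "\<dots> = (1 - b)\<^sup>2 * (norm p)\<^sup>2 - 2 * (1 - b) * (c * b * inner q p) + (c * b)\<^sup>2 * (norm q)\<^sup>2"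
    unfolding power2_norm_eq_inner inner_diff_left inner_diff_right inner_scaleR_left inner_scaleR_right
    by (simp add: inner_commute algebra_simps power2_eq_square)
  finally have "2 * (1 - b) * (c * b * inner q p) \<le> (1 - b)\<^sup>2 * (norm p)\<^sup>2 + (c * b)\<^sup>2 * (norm q)\<^sup>2"
    by simp
  also have "\<dots> = 2 * (1 - b) *
      ((1 - b) / 2 * (norm p)\<^sup>2 + (c * b)\<^sup>2 / (2 * (1 - b)) * (norm q)\<^sup>2)"
    using assms by (simp add: field_simps power2_eq_square)
  finally show ?thesis
    using assms by (subst (asm) mult_le_cancel_left_pos) auto
qed

text \<open>The constants come from \<open>2 |c \<langle>q, p\<rangle>| \<le> t |p|\<^sup>2 + c\<^sup>2 |q|\<^sup>2 / t\<close> with \<open>t = 3/4\<close>. For \<open>d > 0\<close>, any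
  \<open>t\<close> strictly between 1/2 and 1 leaves a positive multiple of both squares.\<close>

lemma quadratic_part_lower_bound:
  fixes p q :: "'a::real_inner" and c d :: real
  assumes "2 * c\<^sup>2 \<le> d"
  shows "(norm p)\<^sup>2 / 8 + d / 6 * (norm q)\<^sup>2 \<le> (norm p)\<^sup>2 / 2 + c * inner q p + d * ((norm q)\<^sup>2 / 2)"
proof -
  have "0 \<le> (norm (3 *\<^sub>R p + (4 * c) *\<^sub>R q))\<^sup>2"
    by simp
  also have "\<dots> = 9 * (norm p)\<^sup>2 + 24 * (c * inner q p) + 16 * (c\<^sup>2 * (norm q)\<^sup>2)"
    unfolding power2_norm_eq_inner inner_add_left inner_add_right inner_scaleR_left inner_scaleR_right
    by (simp add: inner_commute algebra_simps power2_eq_square)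
  finally have "0 \<le> 9 * (norm p)\<^sup>2 + 24 * (c * inner q p) + 16 * (c\<^sup>2 * (norm q)\<^sup>2)" .
  moreover have "2 * (c\<^sup>2 * (norm q)\<^sup>2) \<le> d * (norm q)\<^sup>2"
    using mult_right_mono[OF assms, of "(norm q)\<^sup>2"] by simp
  ultimately show ?thesis
    by simp
qed

lemma filterlim_at_infinity_quadratic_minorant:
  fixes f :: "'a::real_normed_vector \<Rightarrow> real"
  assumes "m > 0" "\<And>x. m * (norm x)\<^sup>2 \<le> f x"
  shows "filterlim f at_top at_infinity"
proof (rule filterlim_at_top_mono)
  have "filterlim (\<lambda>x::'a. (norm x)\<^sup>2) at_top at_infinity"
    by (intro filterlim_pow_at_top filterlim_norm_at_top) auto
  then show "filterlim (\<lambda>x::'a. m * (norm x)\<^sup>2) at_top at_infinity"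
    using assms(1) by (intro filterlim_tendsto_pos_mult_at_top[OF tendsto_const])
qed (use assms(2) in auto)

section \<open>The Lyapunov function\<close>

definition lyapunov :: "real \<Rightarrow> real \<Rightarrow> ('a::real_inner \<Rightarrow> real) \<Rightarrow> 'a \<times> 'a \<Rightarrow> real" where
  "lyapunov c1 c2 \<Phi> =
     (\<lambda>(q, p). (norm p)\<^sup>2 / 2 + \<Phi> q + c1 * inner q p + c2 * ((norm q)\<^sup>2 / 2))"

lemma C1_fun_lyapunov:
  fixes \<Phi> :: "'a::real_inner \<Rightarrow> real"
  assumes "C1_fun \<Phi>"
  shows "C1_fun (lyapunov c1 c2 \<Phi>)"
proof -
  let ?q = "fst_blinfun :: ('a \<times> 'a) \<Rightarrow>\<^sub>L 'a" and ?p = "snd_blinfun :: ('a \<times> 'a) \<Rightarrow>\<^sub>L 'a"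
  have "lyapunov c1 c2 \<Phi> = (\<lambda>z. inner (((1 / 2) *\<^sub>R ?p) z) (?p z) + \<Phi> (?q z)
      + inner ((c1 *\<^sub>R ?q) z) (?p z) + inner (((c2 / 2) *\<^sub>R ?q) z) (?q z))"
    by (auto simp: lyapunov_def fun_eq_iff scaleR_blinfun.rep_eq power2_norm_eq_inner)
  then show ?thesis
    using assms by (simp only:) (intro C1_fun_add C1_fun_inner_blinfun C1_fun_compose_blinfun)
qed

lemma grad_lyapunov_position:
  assumes "GDERIV \<Phi> q :> g"
  shows "grad (\<lambda>q'. lyapunov c1 c2 \<Phi> (q', p)) q = g + c1 *\<^sub>R p + c2 *\<^sub>R q"
proof (rule grad_eqI)
  have "(\<Phi> has_derivative (\<lambda>h. inner h g)) (at q)"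
    using assms by (simp add: gderiv_def)
  then show "GDERIV (\<lambda>q'. lyapunov c1 c2 \<Phi> (q', p)) q :> g + c1 *\<^sub>R p + c2 *\<^sub>R q"
    unfolding lyapunov_def gderiv_def power2_norm_eq_inner
    by (auto intro!: derivative_eq_intros simp: fun_eq_iff inner_add_right inner_commute algebra_simps)
qed

lemma grad_lyapunov_momentum:
  "grad (\<lambda>p'. lyapunov c1 c2 \<Phi> (q, p')) p = p + c1 *\<^sub>R q"
proof (rule grad_eqI)
  show "GDERIV (\<lambda>p'. lyapunov c1 c2 \<Phi> (q, p')) p :> p + c1 *\<^sub>R q"
    unfolding lyapunov_def gderiv_def power2_norm_eq_inner
    by (auto intro!: derivative_eq_intros simp: fun_eq_iff inner_add_right inner_commute algebra_simps)
qed

text \<open>The increment is a quadratic polynomial in the Gaussian vector, as the potential energy does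
  not depend on the momentum.\<close>

lemma lyapunov_refresh_increment:
  fixes q p :: "real ^ 'n"
  shows "has_bochner_integral std_gaussian
    (\<lambda>\<xi>. lyapunov c1 c2 \<Phi> (momentum_refresh phi (q, p) \<xi>) - lyapunov c1 c2 \<Phi> (q, p))
    (- ((sin phi)\<^sup>2 / 2 * (norm p)\<^sup>2) - c1 * (1 - cos phi) * inner q p
      + (sin phi)\<^sup>2 / 2 * real CARD('n))"
proof -
  have pyth: "(sin phi)\<^sup>2 = 1 - (cos phi)\<^sup>2"
    by (rule sin_squared_eq)
  have norm_refresh: "(norm (cos phi *\<^sub>R p + sin phi *\<^sub>R \<xi>))\<^sup>2 =
      (cos phi)\<^sup>2 * (norm p)\<^sup>2 + 2 * (cos phi * sin phi) * inner p \<xi> + (sin phi)\<^sup>2 * (norm \<xi>)\<^sup>2"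
    for \<xi> :: "real ^ 'n"
    unfolding power2_norm_eq_inner
    by (simp add: inner_add_left inner_add_right inner_commute algebra_simps power2_eq_square)
  have increment: "lyapunov c1 c2 \<Phi> (momentum_refresh phi (q, p) \<xi>) - lyapunov c1 c2 \<Phi> (q, p) =
      (- ((sin phi)\<^sup>2 / 2 * (norm p)\<^sup>2) - c1 * (1 - cos phi) * inner q p)
      + inner ((cos phi * sin phi) *\<^sub>R p + (c1 * sin phi) *\<^sub>R q) \<xi>
      + (sin phi)\<^sup>2 / 2 * (norm \<xi>)\<^sup>2" for \<xi>
    unfolding lyapunov_def momentum_refresh_def prod.case fst_conv snd_conv norm_refresh
    by (simp add: pyth inner_add_left inner_add_right field_simps)
  show ?thesis
    unfolding increment by (rule has_bochner_integral_std_gaussian_quadratic)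
qed

lemma lyapunov_in_RHMC_domain:
  fixes \<Phi> :: "real ^ 'n \<Rightarrow> real"
  assumes "C1_fun \<Phi>"
  shows "lyapunov c1 c2 \<Phi> \<in> RHMC_domain phi"
  using C1_fun_lyapunov[OF assms] lyapunov_refresh_increment
  by (fastforce simp: RHMC_domain_def dest: integrable.intros)

text \<open>With \<open>c1\<close> and \<open>c2\<close> as given, the cross terms \<open>c2 \<langle>q, p\<rangle>\<close> of refreshment and transport cancel,
  and refreshment dissipates exactly twice the kinetic term \<open>c1 |p|\<^sup>2\<close> that transport produces.\<close>

lemma RHMC_generator_lyapunov:
  fixes \<Phi> :: "real ^ 'n \<Rightarrow> real"
  assumes "C1_fun \<Phi>"
    and c1: "c1 = inverse lam / 4 * (sin phi)\<^sup>2"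
    and c2: "c2 = inverse lam * c1 * (1 - cos phi)"
  shows "RHMC_generator lam phi \<Phi> (lyapunov c1 c2 \<Phi>) (q, p) =
    - (c1 * (norm p)\<^sup>2) - c1 * inner (grad \<Phi> q) q + 2 * c1 * real CARD('n)"
proof -
  have "RHMC_generator lam phi \<Phi> (lyapunov c1 c2 \<Phi>) (q, p) =
      inverse lam * (- ((sin phi)\<^sup>2 / 2 * (norm p)\<^sup>2) - c1 * (1 - cos phi) * inner q p
        + (sin phi)\<^sup>2 / 2 * real CARD('n))
      + inner p (grad \<Phi> q + c1 *\<^sub>R p + c2 *\<^sub>R q) - inner (grad \<Phi> q) (p + c1 *\<^sub>R q)"
    unfolding RHMC_generator_def prod.case
    by (simp only: has_bochner_integral_integral_eq[OF lyapunov_refresh_increment]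
        grad_lyapunov_position[OF C1_fun_GDERIV_grad[OF assms(1)]] grad_lyapunov_momentum)
  also have "inverse lam * (- ((sin phi)\<^sup>2 / 2 * (norm p)\<^sup>2) - c1 * (1 - cos phi) * inner q p
        + (sin phi)\<^sup>2 / 2 * real CARD('n)) =
      - (2 * c1 * (norm p)\<^sup>2) - c2 * inner q p + 2 * c1 * real CARD('n)"
    (is "?refresh = _")
  proof -
    have "?refresh = (inverse lam * (sin phi)\<^sup>2 / 2) * (real CARD('n) - (norm p)\<^sup>2) - c2 * inner q p"
      by (simp add: c2 algebra_simps add_divide_distrib diff_divide_distrib)
    also have "inverse lam * (sin phi)\<^sup>2 / 2 = 2 * c1"
      by (simp add: c1)
    finally show ?thesis
      by (simp add: algebra_simps)
  qed
  finally show ?thesis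
    by (simp add: inner_add_right inner_commute power2_norm_eq_inner algebra_simps)
qed

lemma lyapunov_drift:
  fixes \<Phi> :: "real ^ 'n \<Rightarrow> real"
  assumes "C1_fun \<Phi>"
    and c1: "c1 = inverse lam / 4 * (sin phi)\<^sup>2"
    and c2: "c2 = inverse lam * c1 * (1 - cos phi)"
    and "c1 \<ge> 0" "b < 1"
    and growth: "1 / 2 * inner (grad \<Phi> q) q
      \<ge> b * \<Phi> q + ((c1 * b)\<^sup>2 + c2 * b * (1 - b)) / (2 * (1 - b)) * (norm q)\<^sup>2 - a"
  shows "RHMC_generator lam phi \<Phi> (lyapunov c1 c2 \<Phi>) (q, p)
    \<le> - (2 * c1 * b) * lyapunov c1 c2 \<Phi> (q, p) + 2 * c1 * (real CARD('n) + a)"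
proof -
  have split: "((c1 * b)\<^sup>2 + c2 * b * (1 - b)) / (2 * (1 - b)) =
      (c1 * b)\<^sup>2 / (2 * (1 - b)) + c2 * b / 2"
    unfolding add_divide_distrib using \<open>b < 1\<close>
    by (simp del: right_diff_distrib_numeral)
  have "b * lyapunov c1 c2 \<Phi> (q, p) =
      b / 2 * (norm p)\<^sup>2 + b * \<Phi> q + c1 * b * inner q p + c2 * b / 2 * (norm q)\<^sup>2"
    by (simp add: lyapunov_def algebra_simps)
  also have "\<dots> \<le> (norm p)\<^sup>2 / 2 + (b * \<Phi> q +
      ((c1 * b)\<^sup>2 + c2 * b * (1 - b)) / (2 * (1 - b)) * (norm q)\<^sup>2)"
    using drift_square[OF \<open>b < 1\<close>, of c1 q p] unfolding split by (simp add: algebra_simps diff_divide_distrib)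
  also have "\<dots> \<le> (norm p)\<^sup>2 / 2 + (1 / 2 * inner (grad \<Phi> q) q + a)"
    using growth by linarith
  finally have "2 * c1 * (b * lyapunov c1 c2 \<Phi> (q, p))
      \<le> 2 * c1 * ((norm p)\<^sup>2 / 2 + (1 / 2 * inner (grad \<Phi> q) q + a))"
    using \<open>c1 \<ge> 0\<close> by (intro mult_left_mono) auto
  then show ?thesis
    unfolding RHMC_generator_lyapunov[OF assms(1) c1 c2] by (simp add: algebra_simps)
qed

lemma lyapunov_quadratic_minorant:
  fixes z :: "'a::real_inner \<times> 'a"
  assumes "2 * c1\<^sup>2 \<le> c2" and "\<And>q. \<Phi> q \<ge> 0"
  shows "min (1 / 8) (c2 / 6) * (norm z)\<^sup>2 \<le> lyapunov c1 c2 \<Phi> z"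
proof (cases z)
  case (Pair q p)
  have "min (1 / 8) (c2 / 6) * (norm z)\<^sup>2 =
      min (1 / 8) (c2 / 6) * (norm q)\<^sup>2 + min (1 / 8) (c2 / 6) * (norm p)\<^sup>2"
    by (simp add: Pair norm_Pair algebra_simps)
  also have "\<dots> \<le> c2 / 6 * (norm q)\<^sup>2 + 1 / 8 * (norm p)\<^sup>2"
    by (intro add_mono mult_right_mono) auto
  also have "\<dots> \<le> lyapunov c1 c2 \<Phi> z"
    using quadratic_part_lower_bound[OF assms(1), of p q] assms(2)[of q]
    by (simp add: Pair lyapunov_def)
  finally show ?thesis .
qed

theorem lemma3p2:
  fixes lam phi c1 c2 :: real
    and \<Phi> :: "real ^ 'n \<Rightarrow> real"
    and V :: "(real ^ 'n) \<times> (real ^ 'n) \<Rightarrow> real"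
  assumes lam: "lam > 0"
    and phi: "0 < phi" "phi \<le> pi / 2"
    and c1: "c1 = inverse lam / 4 * (sin phi)\<^sup>2"
    and c2: "c2 = inverse lam * c1 * (1 - cos phi)"
    and smooth: "C2_fun \<Phi>"
    and H1: "\<And>q. \<Phi> q \<ge> 0"
            "integrable lborel (\<lambda>q. (norm q)\<^sup>2 * exp (- \<Phi> q))"
    and H2: "\<exists>a b. a > 0 \<and> 0 < b \<and> b < 1 \<and>
               (\<forall>q. 1 / 2 * inner (grad \<Phi> q) q
                 \<ge> b * \<Phi> q + ((c1 * b)\<^sup>2 + c2 * b * (1 - b)) / (2 * (1 - b)) * (norm q)\<^sup>2 - a)"
    and V: "\<And>q p. V (q, p) = (norm p)\<^sup>2 / 2 + \<Phi> q + c1 * inner q p + c2 * ((norm q)\<^sup>2 / 2)"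
  shows "V \<in> RHMC_domain phi
    \<and> (\<exists>\<gamma> K. \<gamma> > 0 \<and> K > 0 \<and> (\<forall>z. RHMC_generator lam phi \<Phi> V z \<le> - \<gamma> * V z + K))
    \<and> (\<forall>z. V z \<ge> 0)
    \<and> filterlim V at_top at_infinity"
proof -
  have V_eq: "V = lyapunov c1 c2 \<Phi>"
    by (auto simp: fun_eq_iff lyapunov_def V)
  have C1: "C1_fun \<Phi>"
    using smooth by (rule C2_fun_imp_C1_fun)
  have "sin phi > 0"
    using phi pi_gt_zero by (intro sin_gt_zero) linarith+
  then have "c1 > 0"
    using lam by (simp add: c1)
  have cos: "0 \<le> cos phi" "cos phi < 1"
    using phi pi_gt_zero cos_monotone_0_pi[of 0 phi] by (auto intro!: cos_ge_zero)
  have "c2 > 0"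
    using \<open>c1 > 0\<close> lam cos by (simp add: c2)
  have "2 * c1\<^sup>2 \<le> c2"
  proof -
    have "4 * c1\<^sup>2 = (1 + cos phi) * c2"
      unfolding c2 power2_eq_square
      by (subst (2) c1, simp add: sin_squared_eq) (simp add: algebra_simps power2_eq_square)
    also have "\<dots> \<le> 2 * c2"
      using \<open>c2 > 0\<close> cos by (intro mult_right_mono) auto
    finally show ?thesis by simp
  qed
  note minorant = lyapunov_quadratic_minorant[OF this H1(1)]
  have "0 < min (1 / 8) (c2 / 6)"
    using \<open>c2 > 0\<close> by simp
  then have "V z \<ge> 0" for z
    unfolding V_eq by (intro order_trans[OF _ minorant]) simp
  moreover have "filterlim V at_top at_infinity"
    unfolding V_eq
    by (rule filterlim_at_infinity_quadratic_minorant[OF \<open>0 < min (1 / 8) (c2 / 6)\<close> minorant])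
  moreover have "V \<in> RHMC_domain phi"
    unfolding V_eq using C1 by (rule lyapunov_in_RHMC_domain)
  moreover obtain a b where ab: "a > 0" "0 < b" "b < 1"
    and growth: "\<And>q. 1 / 2 * inner (grad \<Phi> q) q
      \<ge> b * \<Phi> q + ((c1 * b)\<^sup>2 + c2 * b * (1 - b)) / (2 * (1 - b)) * (norm q)\<^sup>2 - a"
    using H2 by blast
  have "RHMC_generator lam phi \<Phi> V z \<le> - (2 * c1 * b) * V z + 2 * c1 * (real CARD('n) + a)" for z
    unfolding V_eq using lyapunov_drift[OF C1 c1 c2 _ ab(3) growth] \<open>c1 > 0\<close>
    by (cases z) auto
  moreover have "2 * c1 * b > 0" "2 * c1 * (real CARD('n) + a) > 0"
    using \<open>c1 > 0\<close> ab by (simp_all add: add_nonneg_pos)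
  ultimately show ?thesis
    by blast
qed

end
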